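(* Fix an integer $k\ge2$, $m\ge1$ and $\varepsilon\in(0,1/k]$. There exist constants $A_{m,k},a_m,B_{m,k},b_m>0$ depending only on $(m,k)$ such that for all $\theta\in\mathcal S_{m,\varepsilon}$ and all $x\in\mathbb{R}$, $$A_{m,k}\,e^{-a_mx^2}\le f_\theta(x)\le B_{m,k}\,e^{-b_mx^2}.$$ Consequently, there exists $K_{m,k}<\infty$ such that $$\sup_{\theta\in\mathcal S_{m,\varepsilon}}|\log f_\theta(x)|\le K_{m,k}(1+x^2)\qquad\text{for all }x\in\mathbb{R}.$$
   Context: For $\theta=(\pi,\mu,t)$ with $\pi\in\Delta_{k-1}=\{\pi\in[0,1]^k:\sum_j\pi_j=1\}$, $\mu\in\mathbb{R}^k$, $t\in\mathbb{R}^k$ and $\sigma_j=e^{t_j}$, the $k$-component Gaussian mixture density is $f_\theta(x)=\sum_{j=1}^k\pi_j\varphi(x;\mu_j,\sigma_j)$, where $\varphi(x;\mu,\sigma)=\frac{1}{\sqrt{2\pi}\,\sigma}\exp(-\frac{(x-\mu)^2}{2\sigma^2})$. The sieve is $\mathcal S_{m,\varepsilon}=\{\pi\in\Delta_{k-1}:\min_j\pi_j\ge\varepsilon\}\times[-m,m]^k\times[-m,m]^k$, in coordinates $(\pi,\mu,t)$. *)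

theory Defs
  imports "HOL-Probability.Distributions"
begin

text \<open>
  Vectors in \<open>\<real>\<^sup>k\<close> are extensional functions on \<open>{1..k}\<close>, so that \<open>k\<close> can be quantified.
  A parameter \<open>\<theta>\<close> is a triple \<open>(p, \<mu>, t)\<close> of such vectors, where \<open>p\<close> is the weight vector
  (the name \<open>pi\<close> being taken by the number).
\<close>

type_synonym param = "(nat \<Rightarrow> real) \<times> (nat \<Rightarrow> real) \<times> (nat \<Rightarrow> real)"

definition prob_simplex :: "nat \<Rightarrow> (nat \<Rightarrow> real) set" where
  "prob_simplex k = {p \<in> {1..k} \<rightarrow>\<^sub>E {0..1}. (\<Sum>j=1..k. p j) = 1}"

definition mixture_density :: "nat \<Rightarrow> param \<Rightarrow> real \<Rightarrow> real" where
  "mixture_density k = (\<lambda>(p, \<mu>, t) x. \<Sum>j=1..k. p j * normal_density (\<mu> j) (exp (t j)) x)"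

definition sieve :: "nat \<Rightarrow> real \<Rightarrow> real \<Rightarrow> param set" where
  "sieve k m \<epsilon> =
     {p \<in> prob_simplex k. Min (p ` {1..k}) \<ge> \<epsilon>} \<times>
     ({1..k} \<rightarrow>\<^sub>E {-m..m}) \<times> ({1..k} \<rightarrow>\<^sub>E {-m..m})"

end

theory Submission imports Defs
begin

text \<open>
  Since \<open>\<bar>\<mu>\<bar> \<le> m\<close> and \<open>exp (- m) \<le> \<sigma> \<le> exp m\<close>, the inequalities
  \<open>(x - \<mu>)\<^sup>2 \<le> 2 * x\<^sup>2 + 2 * m\<^sup>2\<close> and \<open>x\<^sup>2 \<le> 2 * (x - \<mu>)\<^sup>2 + 2 * m\<^sup>2\<close> bound every single component
  by Gaussians that do not depend on \<open>\<theta>\<close>. A mixture is a convex combination of its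
  components, so it obeys the same bounds, whatever the weights are.
\<close>

text \<open>With \<mu> in place of m on the right, the slacks are exactly the squares
  \<open>(x + \<mu>)\<^sup>2\<close> and \<open>(x - 2 * \<mu>)\<^sup>2\<close>.\<close>

lemma square_diff_bounds:
  fixes x \<mu> m :: real
  assumes "\<bar>\<mu>\<bar> \<le> m"
  shows "(x - \<mu>)\<^sup>2 \<le> 2 * x\<^sup>2 + 2 * m\<^sup>2" and "x\<^sup>2 \<le> 2 * (x - \<mu>)\<^sup>2 + 2 * m\<^sup>2"
proof -
  have m: "\<mu>\<^sup>2 \<le> m\<^sup>2"
    using assms by (simp add: abs_le_square_iff[symmetric])
  have "0 \<le> (x + \<mu>)\<^sup>2" "0 \<le> (x - 2 * \<mu>)\<^sup>2"
    by simp_all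
  with m show "(x - \<mu>)\<^sup>2 \<le> 2 * x\<^sup>2 + 2 * m\<^sup>2" and "x\<^sup>2 \<le> 2 * (x - \<mu>)\<^sup>2 + 2 * m\<^sup>2"
    by (simp_all add: power2_eq_square algebra_simps)
qed

text \<open>Separates the prefactor from the exponential factor. Each is monotone in t, so the
  bounds on t can be inserted into them independently.\<close>

lemma normal_density_exp:
  "normal_density \<mu> (exp t) x =
     exp (- t) / sqrt (2 * pi) * exp (- ((x - \<mu>)\<^sup>2 * exp (- (2 * t)) / 2))"
proof -
  have "sqrt (2 * pi * (exp t)\<^sup>2) = sqrt (2 * pi) * exp t"
    by (simp add: real_sqrt_mult)
  moreover have "(exp t)\<^sup>2 = exp (2 * t)"
    by (simp add: exp_double)
  ultimately show ?thesis
    by (simp add: normal_density_def exp_minus field_simps)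
qed

text \<open>The prefactor takes its least value at t = m, while the exponential factor is the
  constant part of the exponent bound at t = -m. Combining opposite extremes of t is lossy but
  uniform in \<theta>.\<close>

definition gauss_lower_const :: "real \<Rightarrow> real" where
  "gauss_lower_const m = exp (- m) / sqrt (2 * pi) * exp (- (m\<^sup>2 * exp (2 * m)))"

definition gauss_upper_const :: "real \<Rightarrow> real" where
  "gauss_upper_const m = exp m / sqrt (2 * pi) * exp (m\<^sup>2 * exp (- (2 * m)) / 2)"

lemma gauss_const_pos: "0 < gauss_lower_const m" "0 < gauss_upper_const m"
  by (simp_all add: gauss_lower_const_def gauss_upper_const_def)

lemma normal_density_lower:
  assumes "\<bar>\<mu>\<bar> \<le> m" and "\<bar>t\<bar> \<le> m"
  shows "gauss_lower_const m * exp (- exp (2 * m) * x\<^sup>2) \<le> normal_density \<mu> (exp t) x"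
proof -
  have "(x - \<mu>)\<^sup>2 * exp (- (2 * t)) \<le> (2 * x\<^sup>2 + 2 * m\<^sup>2) * exp (2 * m)"
    by (rule mult_mono) (use assms square_diff_bounds(1)[OF assms(1)] in auto)
  \<comment> \<open>Halving cancels both factors 2, which gives the rate \<open>exp (2 * m)\<close>.
    Writing the bound as a sum lets \<open>exp_add\<close> split off the constant.\<close>
  then have "- (m\<^sup>2 * exp (2 * m)) + - exp (2 * m) * x\<^sup>2 \<le> - ((x - \<mu>)\<^sup>2 * exp (- (2 * t)) / 2)"
    by (simp add: algebra_simps)
  moreover have "exp (- m) / sqrt (2 * pi) \<le> exp (- t) / sqrt (2 * pi)"
    using assms by (intro divide_right_mono) auto
  ultimately have
    "exp (- m) / sqrt (2 * pi) * exp (- (m\<^sup>2 * exp (2 * m)) + - exp (2 * m) * x\<^sup>2)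
      \<le> exp (- t) / sqrt (2 * pi) * exp (- ((x - \<mu>)\<^sup>2 * exp (- (2 * t)) / 2))"
    by (intro mult_mono) auto
  then show ?thesis
    unfolding normal_density_exp gauss_lower_const_def by (simp only: exp_add mult.assoc)
qed

lemma normal_density_upper:
  assumes "\<bar>\<mu>\<bar> \<le> m" and "\<bar>t\<bar> \<le> m"
  shows "normal_density \<mu> (exp t) x \<le> gauss_upper_const m * exp (- (exp (- (2 * m)) / 4) * x\<^sup>2)"
proof -
  have "x\<^sup>2 * exp (- (2 * m)) \<le> (2 * (x - \<mu>)\<^sup>2 + 2 * m\<^sup>2) * exp (- (2 * m))"
    by (rule mult_right_mono) (use square_diff_bounds(2)[OF assms(1)] in auto)
  moreover have "(x - \<mu>)\<^sup>2 * exp (- (2 * m)) \<le> (x - \<mu>)\<^sup>2 * exp (- (2 * t))"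
    using assms by (intro mult_left_mono) auto
  \<comment> \<open>The rate has denominator 4: a 2 from the Gaussian exponent and another 2 from
    the bound on \<open>x\<^sup>2\<close>.\<close>
  ultimately have "- ((x - \<mu>)\<^sup>2 * exp (- (2 * t)) / 2)
      \<le> m\<^sup>2 * exp (- (2 * m)) / 2 + - (exp (- (2 * m)) / 4) * x\<^sup>2"
    by (simp add: algebra_simps)
  moreover have "exp (- t) / sqrt (2 * pi) \<le> exp m / sqrt (2 * pi)"
    using assms by (intro divide_right_mono) auto
  ultimately have
    "exp (- t) / sqrt (2 * pi) * exp (- ((x - \<mu>)\<^sup>2 * exp (- (2 * t)) / 2))
      \<le> exp m / sqrt (2 * pi) * exp (m\<^sup>2 * exp (- (2 * m)) / 2 + - (exp (- (2 * m)) / 4) * x\<^sup>2)"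
    by (intro mult_mono) auto
  then show ?thesis
    unfolding normal_density_exp gauss_upper_const_def by (simp only: exp_add mult.assoc)
qed

lemma convex_sum_bounds:
  fixes p f :: "'a \<Rightarrow> real"
  assumes "\<And>j. j \<in> S \<Longrightarrow> 0 \<le> p j" and "sum p S = 1"
    and "\<And>j. j \<in> S \<Longrightarrow> L \<le> f j" and "\<And>j. j \<in> S \<Longrightarrow> f j \<le> U"
  shows "L \<le> (\<Sum>j\<in>S. p j * f j)" and "(\<Sum>j\<in>S. p j * f j) \<le> U"
proof -
  have "(\<Sum>j\<in>S. p j * L) \<le> (\<Sum>j\<in>S. p j * f j)" "(\<Sum>j\<in>S. p j * f j) \<le> (\<Sum>j\<in>S. p j * U)"
    using assms by (auto intro!: sum_mono mult_left_mono)
  then show "L \<le> (\<Sum>j\<in>S. p j * f j)" and "(\<Sum>j\<in>S. p j * f j) \<le> U"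
    using assms(2) by (simp_all add: sum_distrib_right[symmetric])
qed

lemma mixture_density_bounds:
  assumes "\<theta> \<in> sieve k m \<epsilon>"
  shows "gauss_lower_const m * exp (- exp (2 * m) * x\<^sup>2) \<le> mixture_density k \<theta> x"
    and "mixture_density k \<theta> x \<le> gauss_upper_const m * exp (- (exp (- (2 * m)) / 4) * x\<^sup>2)"
proof -
  obtain p \<mu> t where \<theta>: "\<theta> = (p, \<mu>, t)"
    by (cases \<theta>)
  from assms have mem: "p \<in> {1..k} \<rightarrow>\<^sub>E {0..1}" "\<mu> \<in> {1..k} \<rightarrow>\<^sub>E {-m..m}" "t \<in> {1..k} \<rightarrow>\<^sub>E {-m..m}"
    and 1: "sum p {1..k} = 1"
    unfolding \<theta> sieve_def prob_simplex_def by blast+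
  have p: "p j \<ge> 0" and \<mu>: "\<bar>\<mu> j\<bar> \<le> m" and t: "\<bar>t j\<bar> \<le> m" if "j \<in> {1..k}" for j
    using mem[THEN PiE_mem, OF that] by auto
  show "gauss_lower_const m * exp (- exp (2 * m) * x\<^sup>2) \<le> mixture_density k \<theta> x"
    and "mixture_density k \<theta> x \<le> gauss_upper_const m * exp (- (exp (- (2 * m)) / 4) * x\<^sup>2)"
    unfolding \<theta> mixture_density_def prod.case
    using convex_sum_bounds[OF p 1 normal_density_lower[OF \<mu> t] normal_density_upper[OF \<mu> t]]
    by simp_all
qed

text \<open>Logarithms turn the bounds into ln A - a x^2 \<le> ln y \<le> ln B - b x^2. On the right
  the quadratic term is at most 0, so only a enters the constant.\<close>

lemma abs_ln_le_of_gaussian_bounds: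
  fixes A a B b x y :: real
  assumes pos: "0 < A" "0 \<le> a" "0 < B" "0 \<le> b"
    and lower: "A * exp (- a * x\<^sup>2) \<le> y" and upper: "y \<le> B * exp (- b * x\<^sup>2)"
  shows "\<bar>ln y\<bar> \<le> (\<bar>ln A\<bar> + \<bar>ln B\<bar> + a) * (1 + x\<^sup>2)"
proof -
  \<comment> \<open>Positivity of y comes first, because the comparison of logarithms below requires
    positive arguments.\<close>
  have "0 < A * exp (- a * x\<^sup>2)"
    using pos by simp
  with lower have y: "0 < y"
    by linarith
  have "ln (A * exp (- a * x\<^sup>2)) \<le> ln y" "ln y \<le> ln (B * exp (- b * x\<^sup>2))"
    using pos y lower upper by (simp_all only: ln_le_cancel_iff mult_pos_pos exp_gt_zero)
  then have "ln A - a * x\<^sup>2 \<le> ln y" "ln y \<le> ln B - b * x\<^sup>2"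
    using pos by (simp_all add: ln_mult)
  \<comment> \<open>With these signs and the expanded right-hand side, the goal is linear in the
    products, which \<open>linarith\<close> treats as atoms.\<close>
  moreover have "0 \<le> b * x\<^sup>2" "0 \<le> \<bar>ln A\<bar> * x\<^sup>2" "0 \<le> \<bar>ln B\<bar> * x\<^sup>2" "0 \<le> a * x\<^sup>2"
    using pos by simp_all
  moreover have "(\<bar>ln A\<bar> + \<bar>ln B\<bar> + a) * (1 + x\<^sup>2) =
      \<bar>ln A\<bar> + \<bar>ln B\<bar> + a + \<bar>ln A\<bar> * x\<^sup>2 + \<bar>ln B\<bar> * x\<^sup>2 + a * x\<^sup>2"
    by (simp add: algebra_simps)
  ultimately show ?thesis
    using pos(2) by linarith
qed

theorem lemma4p1:
  "(\<exists>(A :: real \<Rightarrow> nat \<Rightarrow> real) (a :: real \<Rightarrow> real) (B :: real \<Rightarrow> nat \<Rightarrow> real) (b :: real \<Rightarrow> real).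
      \<forall>(k::nat) (m::real). k \<ge> 2 \<longrightarrow> m \<ge> 1 \<longrightarrow>
        A m k > 0 \<and> a m > 0 \<and> B m k > 0 \<and> b m > 0 \<and>
        (\<forall>\<epsilon>. 0 < \<epsilon> \<longrightarrow> \<epsilon> \<le> 1 / real k \<longrightarrow>
          (\<forall>\<theta> \<in> sieve k m \<epsilon>. \<forall>x::real.
             A m k * exp (- a m * x\<^sup>2) \<le> mixture_density k \<theta> x \<and>
             mixture_density k \<theta> x \<le> B m k * exp (- b m * x\<^sup>2)))) \<and>
   (\<exists>K :: real \<Rightarrow> nat \<Rightarrow> real.
      \<forall>(k::nat) (m::real). k \<ge> 2 \<longrightarrow> m \<ge> 1 \<longrightarrow>
        (\<forall>\<epsilon>. 0 < \<epsilon> \<longrightarrow> \<epsilon> \<le> 1 / real k \<longrightarrow>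
          (\<forall>x::real.
             (SUP \<theta> \<in> sieve k m \<epsilon>. ereal \<bar>ln (mixture_density k \<theta> x)\<bar>) \<le> ereal (K m k * (1 + x\<^sup>2)))))"
proof (intro conjI)
  show "\<exists>(A :: real \<Rightarrow> nat \<Rightarrow> real) (a :: real \<Rightarrow> real) (B :: real \<Rightarrow> nat \<Rightarrow> real) (b :: real \<Rightarrow> real).
      \<forall>(k::nat) (m::real). k \<ge> 2 \<longrightarrow> m \<ge> 1 \<longrightarrow>
        A m k > 0 \<and> a m > 0 \<and> B m k > 0 \<and> b m > 0 \<and>
        (\<forall>\<epsilon>. 0 < \<epsilon> \<longrightarrow> \<epsilon> \<le> 1 / real k \<longrightarrow>
          (\<forall>\<theta> \<in> sieve k m \<epsilon>. \<forall>x::real.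
             A m k * exp (- a m * x\<^sup>2) \<le> mixture_density k \<theta> x \<and>
             mixture_density k \<theta> x \<le> B m k * exp (- b m * x\<^sup>2)))"
    \<comment> \<open>A and B can be constant in k, since averaging any number of components
      preserves their common bounds.\<close>
    by (rule exI[of _ "\<lambda>m k. gauss_lower_const m"], rule exI[of _ "\<lambda>m. exp (2 * m)"],
        rule exI[of _ "\<lambda>m k. gauss_upper_const m"], rule exI[of _ "\<lambda>m. exp (- (2 * m)) / 4"],
        intro allI impI conjI ballI mixture_density_bounds gauss_const_pos) simp_all
  have "\<bar>ln (mixture_density k \<theta> x)\<bar>
      \<le> (\<bar>ln (gauss_lower_const m)\<bar> + \<bar>ln (gauss_upper_const m)\<bar> + exp (2 * m)) * (1 + x\<^sup>2)"
    if "\<theta> \<in> sieve k m \<epsilon>" for k m \<epsilon> \<theta> x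
    by (rule abs_ln_le_of_gaussian_bounds[OF _ _ _ _ mixture_density_bounds[OF that]])
      (simp_all add: gauss_const_pos)
  then show "\<exists>K :: real \<Rightarrow> nat \<Rightarrow> real.
      \<forall>(k::nat) (m::real). k \<ge> 2 \<longrightarrow> m \<ge> 1 \<longrightarrow>
        (\<forall>\<epsilon>. 0 < \<epsilon> \<longrightarrow> \<epsilon> \<le> 1 / real k \<longrightarrow>
          (\<forall>x::real.
             (SUP \<theta> \<in> sieve k m \<epsilon>. ereal \<bar>ln (mixture_density k \<theta> x)\<bar>) \<le> ereal (K m k * (1 + x\<^sup>2))))"
    \<comment> \<open>The supremum lives in the complete lattice \<open>ereal\<close>, so the
      pointwise bound, uniform in \<theta>, suffices without a separate boundedness
      argument.\<close>
    by (intro exI[of _ "\<lambda>m k. \<bar>ln (gauss_lower_const m)\<bar> + \<bar>ln (gauss_upper_const m)\<bar> + exp (2 * m)"]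
        allI impI SUP_least) simp
qed

end
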